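(* Let $\lambda\in\mathbb{C}$ be a strong PV number of degree $d$, and let $\mathcal{M}=(\mathbb{R}^k,F,L)$ be the associated cut-and-project scheme (defined in the context). For any finite $S\subseteq\mathbb{Z}[\lambda]$, the set $Q_\lambda(S)$ is a subset of some model set of $\mathcal{M}$.
   Context: For $\lambda\in\mathbb{C}$, a set $A\subseteq\mathbb{C}$ is $\lambda$-convex if for all $a,b\in A$ the point $(1-\lambda)a+\lambda b$ is in $A$; $Q_\lambda(S)$ denotes the smallest $\lambda$-convex set containing $S$. A strong PV number is an algebraic integer $\alpha\in\mathbb{C}$ all of whose Galois conjugates over $\mathbb{Q}$, other than $\alpha$ and its complex conjugate $\alpha^*$, lie in the open interval $(0,1)$. The scheme $\mathcal{M}$: let $\lambda$ be a strong PV number of degree $d$, let $\mu_0,\ldots,\mu_{k-1}$ be its conjugates (other than $\lambda,\lambda^*$) in $(0,1)$, and put $\mu_k:=\lambda$. So $k=d-1$ if $\lambda\in\mathbb{R}$ and $k=d-2$ otherwise (if $k=0$, $\mathbb{R}^k$ is a one-point space). Let $F:=\mathbb{R}$ if $\lambda\in\mathbb{R}$ and $F:=\mathbb{C}\cong\mathbb{R}^2$ otherwise. For $0\le j<d$ let $\mathbf{u}_j:=((\mu_0)^j,\ldots,(\mu_{k-1})^j,(\mu_k)^j)\in\mathbb{R}^k\times F$, and let $L:=\left\{\sum_{j=0}^{d-1}a_j\mathbf{u}_j : a_0,\ldots,a_{d-1}\in\mathbb{Z}\right\}\subseteq\mathbb{R}^k\times F$. Let $\pi_1:\mathbb{R}^k\times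 F\to\mathbb{R}^k$ and $\pi_2:\mathbb{R}^k\times F\to F$ be the canonical projections. A window is a relatively compact subset $W\subseteq\mathbb{R}^k$ with nonempty interior. A model set of $\mathcal{M}$ is a set of the form $\pi_2(L\cap\pi_1^{-1}(W))\subseteq F$ for some window $W$. *)

theory Defs
  imports
    "HOL-Analysis.Analysis"
    "HOL-Computational_Algebra.Fundamental_Theorem_Algebra"
    "HOL-Computational_Algebra.Polynomial_Factorial"
    "HOL-Computational_Algebra.Field_as_Ring"
begin

subsection \<open>Minimal polynomials and Galois conjugates over the rationals\<close>

definition rat_min_poly :: "complex \<Rightarrow> rat poly" where
  "rat_min_poly \<alpha> = (THE p. lead_coeff p = 1 \<and> irreducible p \<and> poly (map_poly of_rat p) \<alpha> = 0)"

definition alg_degree :: "complex \<Rightarrow> nat" where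
  "alg_degree \<alpha> = degree (rat_min_poly \<alpha>)"

definition galois_conjugates :: "complex \<Rightarrow> complex set" where
  "galois_conjugates \<alpha> = {z. poly (map_poly of_rat (rat_min_poly \<alpha>)) z = 0}"

lemma map_poly_of_rat_mult:
  "map_poly of_rat (p * q) = (map_poly of_rat p * map_poly of_rat q :: complex poly)"
  by (rule poly_eqI) (simp add: coeff_map_poly coeff_mult of_rat_sum of_rat_mult)

lemma map_poly_of_rat_add:
  "map_poly of_rat (p + q) = (map_poly of_rat p + map_poly of_rat q :: complex poly)"
  by (rule poly_eqI) (simp add: coeff_map_poly of_rat_add)

text \<open>The next two facts justify the definite description in \<^const>\<open>rat_min_poly\<close>.\<close>

lemma ex1_rat_min_poly:
  fixes \<alpha> :: complex
  assumes "algebraic \<alpha>"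
  shows "\<exists>!p :: rat poly. lead_coeff p = 1 \<and> irreducible p \<and> poly (map_poly of_rat p) \<alpha> = 0"
proof -
  let ?ev = "\<lambda>p :: rat poly. poly (map_poly of_rat p) \<alpha>"
  have "\<exists>p :: rat poly. p \<noteq> 0 \<and> ?ev p = 0"
  proof -
    from assms obtain q where q: "\<And>i. coeff q i \<in> \<rat>" "q \<noteq> 0" "poly q \<alpha> = 0"
      unfolding algebraic_altdef by blast
    obtain p where "q = map_poly of_rat p"
      using ratpolyE[of q] q(1) by blast
    with q have "p \<noteq> 0 \<and> ?ev p = 0" by auto
    then show ?thesis ..
  qed
  then obtain p where p: "p \<noteq> 0" "?ev p = 0"
    and least: "\<And>q. q \<noteq> 0 \<Longrightarrow> ?ev q = 0 \<Longrightarrow> degree p \<le> degree q"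
    using ex_has_least_nat[of "\<lambda>p. p \<noteq> 0 \<and> ?ev p = 0" _ degree] by blast
  have dvd: "p dvd q" if "?ev q = 0" for q
  proof -
    have "q = q div p * p + q mod p" by simp
    then have "?ev q = ?ev (q div p) * ?ev p + ?ev (q mod p)"
      by (metis map_poly_of_rat_add map_poly_of_rat_mult poly_add poly_mult)
    with that p have "?ev (q mod p) = 0" by simp
    with least[of "q mod p"] degree_mod_less[of p q] p(1) show ?thesis
      by (metis mod_eq_0_iff_dvd not_le)
  qed
  have nunit: "\<not> is_unit p"
  proof
    assume "is_unit p"
    then obtain c where "p = [:c:]" by (auto simp: is_unit_poly_iff)
    with p show False by (simp add: map_poly_pCons)
  qed
  have irr: "irreducible p"
  proof (rule irreducibleI[OF p(1) nunit])
    fix a b assume ab: "p = a * b"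
    then have nz: "a \<noteq> 0" "b \<noteq> 0" using p(1) by auto
    have "?ev a * ?ev b = 0" using p(2) unfolding ab by (simp add: map_poly_of_rat_mult)
    then consider "?ev a = 0" | "?ev b = 0" by auto
    then show "is_unit a \<or> is_unit b"
    proof cases
      case 1
      then have "degree b = 0"
        using least[OF nz(1)] degree_mult_eq[OF nz] ab by simp
      then show ?thesis using nz by (simp add: is_unit_iff_degree)
    next
      case 2
      then have "degree a = 0"
        using least[OF nz(2)] degree_mult_eq[OF nz] ab by simp
      then show ?thesis using nz by (simp add: is_unit_iff_degree)
    qed
  qed
  define m where "m = smult (inverse (lead_coeff p)) p"
  have m_monic: "lead_coeff m = 1" using p(1) by (simp add: m_def)
  have m_dvd: "m dvd q" if "?ev q = 0" for q
    using dvd[OF that] p(1) by (simp add: m_def smult_dvd_iff)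
  have m_eq: "m = [:inverse (lead_coeff p):] * p" by (simp add: m_def)
  have "is_unit [:inverse (lead_coeff p):]" using p(1) by (simp add: is_unit_const_poly_iff dvd_field_iff)
  then have "irreducible m" unfolding m_eq
    using irr by (simp only: irreducible_mult_unit_left)
  moreover have "?ev m = 0" unfolding m_eq map_poly_of_rat_mult using p(2) by simp
  moreover have "q = m" if q: "lead_coeff q = 1" "irreducible q" "?ev q = 0" for q
  proof -
    from m_dvd[OF q(3)] obtain r where r: "q = m * r" by blast
    have "\<not> is_unit m" using \<open>irreducible m\<close> irreducible_not_unit by blast
    with q(2) r have "is_unit r" using irreducibleD by blast
    then obtain c where c: "r = [:c:]" by (auto simp: is_unit_poly_iff)
    have "lead_coeff q = lead_coeff m * lead_coeff r" unfolding r by (rule lead_coeff_mult)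
    with q(1) m_monic c have "c = 1" by simp
    with r c show "q = m" by simp
  qed
  ultimately show ?thesis using m_monic by blast
qed

lemma rat_min_poly:
  assumes "algebraic \<alpha>"
  shows "lead_coeff (rat_min_poly \<alpha>) = 1" "irreducible (rat_min_poly \<alpha>)"
    "poly (map_poly of_rat (rat_min_poly \<alpha>)) \<alpha> = 0"
  using theI'[OF ex1_rat_min_poly[OF assms]] unfolding rat_min_poly_def by auto

definition strong_PV :: "complex \<Rightarrow> bool" where
  "strong_PV \<alpha> \<longleftrightarrow> algebraic_int \<alpha> \<and>
     (\<forall>z \<in> galois_conjugates \<alpha> - {\<alpha>, cnj \<alpha>}. z \<in> complex_of_real ` {0<..<1})"


subsection \<open>The ring generated by a complex number\<close>

definition int_adjoin :: "complex \<Rightarrow> complex set" where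
  "int_adjoin \<alpha> = {poly (map_poly of_int p) \<alpha> | p :: int poly. True}"


subsection \<open>\<open>\<lambda>\<close>-convexity\<close>

definition lambda_convex :: "complex \<Rightarrow> complex set \<Rightarrow> bool" where
  "lambda_convex lam A \<longleftrightarrow> (\<forall>a\<in>A. \<forall>b\<in>A. (1 - lam) * a + lam * b \<in> A)"

definition Q_hull :: "complex \<Rightarrow> complex set \<Rightarrow> complex set" where
  "Q_hull lam S = lambda_convex lam hull S"

lemma lambda_convex_Q_hull: "lambda_convex lam (Q_hull lam S)"
  unfolding Q_hull_def hull_def lambda_convex_def by blast


subsection \<open>The cut-and-project scheme of a strong PV number\<close>

text \<open>
  The dimension \<open>k\<close> of the internal space depends on \<open>\<lambda>\<close> and may be \<open>0\<close>, so \<open>\<real>\<^sup>k\<close> is rendered as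
  \<^term>\<open>Euclidean_space k\<close>, whose points are the functions \<^typ>\<open>nat \<Rightarrow> real\<close> vanishing at all
  indices \<open>\<ge> k\<close>. The physical space \<open>F\<close> is a subset of the complex plane: the real axis
  if \<open>\<lambda>\<close> is real, and the whole plane otherwise.
\<close>

definition internal_dim :: "complex \<Rightarrow> nat" where
  "internal_dim lam = (if lam \<in> \<real> then alg_degree lam - 1 else alg_degree lam - 2)"

definition physical_space :: "complex \<Rightarrow> complex set" where
  "physical_space lam = (if lam \<in> \<real> then \<real> else UNIV)"

definition enumerates_conjugates :: "complex \<Rightarrow> (nat \<Rightarrow> real) \<Rightarrow> bool" where
  "enumerates_conjugates lam \<mu> \<longleftrightarrow>
     bij_betw (\<lambda>i. complex_of_real (\<mu> i)) {..<internal_dim lam}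
       (galois_conjugates lam - {lam, cnj lam})"

definition lattice_vec :: "complex \<Rightarrow> (nat \<Rightarrow> real) \<Rightarrow> nat \<Rightarrow> (nat \<Rightarrow> real) \<times> complex" where
  "lattice_vec lam \<mu> j = ((\<lambda>i. if i < internal_dim lam then \<mu> i ^ j else 0), lam ^ j)"

definition scheme_lattice :: "complex \<Rightarrow> (nat \<Rightarrow> real) \<Rightarrow> ((nat \<Rightarrow> real) \<times> complex) set" where
  "scheme_lattice lam \<mu> =
     {((\<lambda>i. \<Sum>j<alg_degree lam. of_int (a j) * fst (lattice_vec lam \<mu> j) i),
       (\<Sum>j<alg_degree lam. of_int (a j) * snd (lattice_vec lam \<mu> j))) | a :: nat \<Rightarrow> int. True}"

lemma scheme_lattice_subset:
  "scheme_lattice lam \<mu> \<subseteq> topspace (Euclidean_space (internal_dim lam)) \<times> physical_space lam"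
  by (auto simp: scheme_lattice_def lattice_vec_def physical_space_def topspace_Euclidean_space
      intro!: Reals_mult Reals_power)

definition window :: "nat \<Rightarrow> (nat \<Rightarrow> real) set \<Rightarrow> bool" where
  "window k W \<longleftrightarrow> W \<subseteq> topspace (Euclidean_space k) \<and>
     compactin (Euclidean_space k) (Euclidean_space k closure_of W) \<and>
     Euclidean_space k interior_of W \<noteq> {}"

definition model_set :: "complex \<Rightarrow> (nat \<Rightarrow> real) \<Rightarrow> complex set \<Rightarrow> bool" where
  "model_set lam \<mu> M \<longleftrightarrow>
     (\<exists>W. window (internal_dim lam) W \<and> M = snd ` (scheme_lattice lam \<mu> \<inter> fst -` W))"


text \<open>
  The prescribed value of \<^const>\<open>internal_dim\<close> is the number of remaining conjugates, so that
  every strong PV number has an enumeration as required by \<^const>\<open>enumerates_conjugates\<close>.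
\<close>

lemma card_galois_conjugates:
  assumes "algebraic \<alpha>"
  shows "card (galois_conjugates \<alpha>) = alg_degree \<alpha>" "finite (galois_conjugates \<alpha>)"
proof -
  let ?h = "map_poly of_rat :: rat poly \<Rightarrow> complex poly"
  define p where "p = rat_min_poly \<alpha>"
  note p = rat_min_poly[OF assms, folded p_def]
  have "p \<noteq> 0" using p(2) by auto
  then have hp0: "?h p \<noteq> 0" by (simp add: map_poly_eq_0_iff)
  have deg: "degree (?h p) = degree p" by (simp add: degree_map_poly)
  have dpos: "degree p > 0"
    using irreducible_not_unit[OF p(2)] is_unit_iff_degree[OF \<open>p \<noteq> 0\<close>] by simp
  have pd: "pderiv (?h p) = ?h (pderiv p)"
    by (rule poly_eqI) (simp add: coeff_map_poly coeff_pderiv of_rat_mult of_rat_add)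
  have "pderiv p \<noteq> 0" using dpos by (simp add: pderiv_eq_0_iff)
  have "\<not> p dvd pderiv p"
    using \<open>pderiv p \<noteq> 0\<close> dpos dvd_imp_degree_le[of p "pderiv p"] by (simp add: degree_pderiv)
  then have "coprime p (pderiv p)"
    by (rule prime_elem_imp_coprime[OF irreducible_imp_prime_elem[OF p(2)]])
  then obtain a b where ab: "a * p + b * pderiv p = 1"
    using bezout_coefficients_fst_snd[of p "pderiv p"] unfolding coprime_iff_gcd_eq_1 by metis
  have "rsquarefree (?h p)"
    unfolding rsquarefree_roots
  proof (intro allI notI, elim conjE)
    fix z assume z: "poly (?h p) z = 0" "poly (pderiv (?h p)) z = 0"
    have "?h a * ?h p + ?h b * ?h (pderiv p) = 1"
      using arg_cong[OF ab, of ?h] by (simp add: map_poly_of_rat_add map_poly_of_rat_mult)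
    then have "poly (?h a * ?h p + ?h b * ?h (pderiv p)) z = 1" by simp
    with z show False by (simp add: pd)
  qed
  let ?P = "\<Prod>z | poly (?h p) z = 0. [:- z, 1:]"
  from \<open>rsquarefree (?h p)\<close> have "smult (lead_coeff (?h p)) ?P = ?h p"
    by (rule complex_poly_decompose_rsquarefree)
  then have "degree (?h p) = degree (smult (lead_coeff (?h p)) ?P)"
    by (rule arg_cong[OF sym])
  also have "\<dots> = degree ?P"
    unfolding degree_smult_eq using hp0 by (simp only: leading_coeff_0_iff if_False)
  also have "\<dots> = card {z. poly (?h p) z = 0}"
    by (subst degree_prod_eq_sum_degree) auto
  finally have "card {z. poly (?h p) z = 0} = degree (?h p)" ..
  then show "card (galois_conjugates \<alpha>) = alg_degree \<alpha>"
    by (simp add: galois_conjugates_def alg_degree_def deg flip: p_def)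
  show "finite (galois_conjugates \<alpha>)"
    using poly_roots_finite[OF hp0] by (simp add: galois_conjugates_def flip: p_def)
qed

lemma ex_enumerates_conjugates:
  assumes "strong_PV lam"
  shows "\<exists>\<mu>. enumerates_conjugates lam \<mu>"
proof -
  from assms have alg: "algebraic lam" by (auto simp: strong_PV_def)
  let ?G = "galois_conjugates lam" and ?R = "galois_conjugates lam - {lam, cnj lam}"
  have in1: "lam \<in> ?G" using rat_min_poly[OF alg] by (simp add: galois_conjugates_def)
  have "cnj (poly (map_poly of_rat p) z) = poly (map_poly of_rat p) (cnj z)" for p :: "rat poly" and z
  proof (rule poly_cnj_real)
    have "(of_rat q :: complex) \<in> \<real>" for q
      by (induction q) (simp add: of_rat_rat)
    then show "coeff (map_poly of_rat p) n \<in> (\<real> :: complex set)" for n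
      by (simp add: coeff_map_poly)
  qed
  then have in2: "cnj lam \<in> ?G" using in1
    by (metis (mono_tags, lifting) complex_cnj_zero galois_conjugates_def mem_Collect_eq)
  have "card ?R = internal_dim lam"
  proof (cases "lam \<in> \<real>")
    case True
    then have "?R = ?G - {lam}" by (auto simp: Reals_cnj_iff)
    then show ?thesis using True in1 card_galois_conjugates[OF alg]
      by (simp add: internal_dim_def)
  next
    case False
    then have "card {lam, cnj lam} = 2" by (auto simp: Reals_cnj_iff card_insert_if)
    then show ?thesis using False in1 in2 card_galois_conjugates[OF alg]
      by (simp add: internal_dim_def card_Diff_subset)
  qed
  moreover have "finite ?R" using card_galois_conjugates[OF alg] by simp
  ultimately obtain f where f: "bij_betw f {..<internal_dim lam} ?R"
    using finite_same_card_bij[of "{..<internal_dim lam}" ?R] by auto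
  have "complex_of_real (Re (f i)) = f i" if "i < internal_dim lam" for i
  proof -
    have "f i \<in> ?R" using f that by (auto simp: bij_betw_def)
    then have "f i \<in> complex_of_real ` {0<..<1}" using assms by (auto simp: strong_PV_def)
    then show ?thesis by auto
  qed
  then have "enumerates_conjugates lam (\<lambda>i. Re (f i))"
    unfolding enumerates_conjugates_def using f by (subst bij_betw_cong[of _ _ f]) auto
  then show ?thesis by blast
qed

end

theory Submission
  imports Defs
begin

text \<open>
  Writing an element of \<open>\<int>[\<lambda>]\<close> as \<open>p(\<lambda>)\<close> with \<open>p\<close> an integer polynomial, passing to
  \<open>(1 - \<lambda>) p(\<lambda>) + \<lambda> q(\<lambda>)\<close> replaces the conjugate values by \<open>(1 - \<mu>\<^sub>i) p(\<mu>\<^sub>i) + \<mu>\<^sub>i q(\<mu>\<^sub>i)\<close>.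
  As \<open>0 < \<mu>\<^sub>i < 1\<close>, this is a convex combination of \<open>p(\<mu>\<^sub>i)\<close> and \<open>q(\<mu>\<^sub>i)\<close>, so a bound \<open>B\<close> on
  the conjugate values over \<open>S\<close> persists on all of \<open>Q\<^sub>\<lambda>(S)\<close>, and the box \<open>[-B, B]\<^sup>k\<close> serves as the
  window. By Gauss's lemma the minimal polynomial of \<open>\<lambda>\<close> is integral, so division by it writes
  each \<open>p(\<lambda>)\<close> in terms of \<open>1, \<lambda>, \<dots>, \<lambda>\<^bsup>d-1\<^esup>\<close> without changing the conjugate values.
\<close>

subsection \<open>Integer polynomials\<close>

lemma map_poly_of_int_add:
  "map_poly of_int (p + q) = (map_poly of_int p + map_poly of_int q :: 'a :: comm_ring_1 poly)"
  by (rule poly_eqI) (simp add: coeff_map_poly)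

lemma map_poly_of_int_mult:
  "map_poly of_int (p * q) = (map_poly of_int p * map_poly of_int q :: 'a :: comm_ring_1 poly)"
  by (rule poly_eqI) (simp add: coeff_map_poly coeff_mult)

lemma map_poly_of_int_inj:
  assumes "map_poly of_int p = (map_poly of_int q :: 'a :: ring_char_0 poly)"
  shows "p = q"
proof (rule poly_eqI)
  fix n
  have "coeff (map_poly of_int p) n = (coeff (map_poly of_int q) n :: 'a)"
    using assms by simp
  then show "coeff p n = coeff q n" by (simp add: coeff_map_poly)
qed

lemma poly_map_poly_of_int_of_real:
  "poly (map_poly of_int p) (of_real x :: complex) = of_real (poly (map_poly of_int p) x)"
  by (induction p) (auto simp: map_poly_pCons)

lemma map_poly_of_rat_of_int:
  "map_poly of_rat (map_poly of_int p) = (map_poly of_int p :: complex poly)"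
  by (rule poly_eqI) (simp add: coeff_map_poly)

lemma poly_map_poly_of_int_eq_sum:
  fixes x :: "'a :: {comm_ring_1, ring_char_0}"
  assumes "degree p < d"
  shows "poly (map_poly of_int p) x = (\<Sum>j<d. of_int (coeff p j) * x ^ j)"
proof -
  have "poly (map_poly of_int p) x = (\<Sum>j\<le>degree p. of_int (coeff p j) * x ^ j)"
    by (simp add: poly_altdef degree_map_poly coeff_map_poly)
  also have "\<dots> = (\<Sum>j<d. of_int (coeff p j) * x ^ j)"
    using assms by (intro sum.mono_neutral_left) (auto simp: coeff_eq_0)
  finally show ?thesis .
qed

lemma rat_poly_clear_denominators:
  fixes p :: "rat poly"
  obtains a :: int and P :: "int poly" where "a > 0" "map_poly of_int P = smult (of_int a) p"
proof -
  have "\<exists>a P. a > 0 \<and> map_poly of_int P = smult (of_int a) p"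
  proof (induction p)
    case 0
    show ?case by (intro exI[of _ 1] exI[of _ 0]) simp
  next
    case (pCons c p)
    then obtain a P where aP: "a > 0" "map_poly of_int P = smult (of_int a) p" by blast
    obtain u v where uv: "quotient_of c = (u, v)" by force
    have v: "v > 0" "c = of_int u / of_int v"
      using quotient_of_denom_pos[OF uv] quotient_of_div[OF uv] by auto
    \<comment> \<open>Scaling by \<open>a * v\<close> turns the head \<open>c = u / v\<close> into
      \<open>a * u\<close> and the tail into \<open>v\<close> times \<open>P\<close>.\<close>
    have "map_poly of_int (pCons (a * u) (smult v P)) = smult (of_int (a * v)) (pCons c p)"
    proof (rule poly_eqI)
      fix n
      have "of_int (coeff P m) = of_int a * coeff p m" for m
        using arg_cong[OF aP(2), of "\<lambda>r. coeff r m"] by (simp add: coeff_map_poly)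
      then show "coeff (map_poly of_int (pCons (a * u) (smult v P))) n
          = coeff (smult (of_int (a * v)) (pCons c p)) n"
        using v by (simp add: coeff_map_poly coeff_pCons split: nat.split)
    qed
    moreover have "a * v > 0" using aP v by simp
    ultimately show ?case by blast
  qed
  then show ?thesis using that by blast
qed

text \<open>This is Gauss's lemma for monic polynomials. Once denominators are cleared,
  multiplicativity of the content gives \<open>content P * content R = a * b\<close>. As
  \<open>q\<close> is monic, \<open>content R\<close> divides \<open>b\<close>, which forces
  \<open>a\<close> to divide \<open>content P\<close>, so \<open>P\<close> can be divided by
  \<open>a\<close> over the integers.\<close>

lemma monic_rat_factor_of_monic_int_poly:
  fixes m q :: "rat poly" and f :: "int poly"
  assumes f: "map_poly of_int f = m * q" and monic: "lead_coeff f = 1" "lead_coeff m = 1"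
  obtains M where "m = map_poly of_int M"
proof -
  have lcf: "lead_coeff (map_poly of_int f :: rat poly) = 1"
    using monic by (simp add: degree_map_poly coeff_map_poly)
  then have lcq: "lead_coeff q = 1"
    using monic(2) unfolding f lead_coeff_mult by simp
  obtain a P where aP: "a > 0" "map_poly of_int P = smult (of_int a) m"
    by (rule rat_poly_clear_denominators)
  obtain b R where bR: "b > 0" "map_poly of_int R = smult (of_int b) q"
    by (rule rat_poly_clear_denominators)
  have lead: "lead_coeff P = a" if "map_poly of_int P = smult (of_int a) m" "lead_coeff m = 1"
    for P a and m :: "rat poly"
  proof -
    have "lead_coeff (map_poly of_int P :: rat poly) = of_int a"
      unfolding that(1) lead_coeff_smult using that(2) by simp
    then show ?thesis by (simp add: degree_map_poly coeff_map_poly)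
  qed
  have "map_poly of_int (P * R) = (map_poly of_int (smult (a * b) f) :: rat poly)"
    unfolding map_poly_of_int_mult aP bR
    by (rule poly_eqI) (simp add: coeff_map_poly flip: f)
  then have PR: "P * R = smult (a * b) f" by (rule map_poly_of_int_inj)
  have "content f dvd 1" using content_dvd_coeff[of f "degree f"] monic by simp
  then have "content f = 1" by (simp only: is_unit_content_iff)
  then have eq: "content P * content R = a * b"
    using arg_cong[OF PR, of content] aP bR
    by (simp add: content_mult abs_mult normalize_mult)
  have "content R dvd b" using content_dvd_coeff[of R "degree R"] lead[OF bR(2) lcq] by simp
  then obtain c where c: "b = content R * c" by blast
  have "content R \<noteq> 0" using c bR by auto
  with eq c have "content P = a * c" by simp
  then have dvd: "a dvd coeff P n" for n
    using content_dvd_coeff[of P n] by (metis dvd_mult_left)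
  define M where "M = map_poly (\<lambda>x. x div a) P"
  have "m = map_poly of_int M"
  proof (rule poly_eqI)
    fix n
    obtain k where k: "coeff P n = a * k" using dvd by blast
    have "of_int (coeff P n) = of_int a * coeff m n"
      using arg_cong[OF aP(2), of "\<lambda>r. coeff r n"] by (simp add: coeff_map_poly)
    then show "coeff m n = coeff (map_poly of_int M) n"
      using k aP by (simp add: coeff_map_poly M_def)
  qed
  then show ?thesis by (rule that)
qed

subsection \<open>The minimal polynomial of an algebraic integer\<close>

text \<open>If the irreducible polynomial did not divide \<open>p\<close>, the two would be coprime,
  and a Bezout identity evaluated at the common root \<alpha> would read 0 = 1.\<close>

lemma rat_min_poly_dvd:
  assumes alg: "algebraic \<alpha>" and root: "poly (map_poly of_rat p) \<alpha> = 0"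
  shows "rat_min_poly \<alpha> dvd p"
proof (rule ccontr)
  let ?m = "rat_min_poly \<alpha>" and ?h = "map_poly of_rat :: rat poly \<Rightarrow> complex poly"
  assume "\<not> ?m dvd p"
  then have "coprime ?m p"
    by (rule prime_elem_imp_coprime[OF irreducible_imp_prime_elem[OF rat_min_poly(2)[OF alg]]])
  then obtain a b where ab: "a * ?m + b * p = 1"
    using bezout_coefficients_fst_snd[of ?m p] unfolding coprime_iff_gcd_eq_1 by metis
  have "?h a * ?h ?m + ?h b * ?h p = 1"
    using arg_cong[OF ab, of ?h] by (simp add: map_poly_of_rat_add map_poly_of_rat_mult)
  then have "poly (?h a * ?h ?m + ?h b * ?h p) \<alpha> = 1" by simp
  with root rat_min_poly(3)[OF alg] show False by simp
qed

lemma rat_min_poly_integral: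
  assumes "algebraic_int \<alpha>"
  obtains M where "rat_min_poly \<alpha> = map_poly of_int M" "lead_coeff M = 1"
    "degree M = alg_degree \<alpha>" "alg_degree \<alpha> > 0"
proof -
  from assms have alg: "algebraic \<alpha>" by blast
  note m = rat_min_poly[OF alg]
  from assms obtain f where f: "poly (map_poly of_int f) \<alpha> = 0" "lead_coeff f = 1"
    unfolding algebraic_int_altdef_ipoly by blast
  have "rat_min_poly \<alpha> dvd map_poly of_int f"
    by (rule rat_min_poly_dvd[OF alg]) (simp add: map_poly_of_rat_of_int f)
  then obtain q where "map_poly of_int f = rat_min_poly \<alpha> * q" by blast
  from monic_rat_factor_of_monic_int_poly[OF this f(2) m(1)]
  obtain M where M: "rat_min_poly \<alpha> = map_poly of_int M" .
  have deg: "degree M = alg_degree \<alpha>" by (simp add: alg_degree_def M degree_map_poly)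
  have "lead_coeff M = 1" using m(1) unfolding M by (simp add: degree_map_poly coeff_map_poly)
  moreover have "alg_degree \<alpha> > 0"
    using m(2) irreducible_not_unit[OF m(2)] is_unit_iff_degree[of "rat_min_poly \<alpha>"]
    by (cases "rat_min_poly \<alpha> = 0") (auto simp: alg_degree_def)
  ultimately show ?thesis using that M deg by blast
qed

text \<open>The integral minimal polynomial vanishes at every conjugate, so one remainder
  \<open>r\<close> serves all conjugates at once.\<close>

lemma int_poly_reduce_degree:
  assumes "algebraic_int \<alpha>"
  obtains r where "degree r < alg_degree \<alpha>"
    "\<And>z. z \<in> galois_conjugates \<alpha> \<Longrightarrow> poly (map_poly of_int r) z = poly (map_poly of_int p) z"
proof -
  obtain M where M: "rat_min_poly \<alpha> = map_poly of_int M" "lead_coeff M = 1"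
    "degree M = alg_degree \<alpha>" "alg_degree \<alpha> > 0"
    using rat_min_poly_integral[OF assms] .
  have "M \<noteq> 0" using M by auto
  \<comment> \<open>Pseudo-division stays within integer polynomials. It is exact division here,
    since its scaling factor is a power of \<open>lead_coeff M = 1\<close>.\<close>
  obtain q r where qr: "pseudo_divmod p M = (q, r)" by force
  have p: "p = M * q + r" and r: "r = 0 \<or> degree r < degree M"
    using pseudo_divmod[OF \<open>M \<noteq> 0\<close> qr] M(2) by auto
  have "poly (map_poly of_int r) z = poly (map_poly of_int p) z" if "z \<in> galois_conjugates \<alpha>" for z
  proof -
    have "poly (map_poly of_int M) z = 0"
      using that by (simp add: galois_conjugates_def M map_poly_of_rat_of_int)
    then show ?thesis by (simp add: p map_poly_of_int_add map_poly_of_int_mult)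
  qed
  moreover have "degree r < alg_degree \<alpha>" using r M by auto
  ultimately show ?thesis using that by blast
qed

subsection \<open>The box as a window\<close>

definition box_window :: "nat \<Rightarrow> real \<Rightarrow> (nat \<Rightarrow> real) set" where
  "box_window k B = {x. (\<forall>i<k. \<bar>x i\<bar> \<le> B) \<and> (\<forall>i\<ge>k. x i = 0)}"

text \<open>The box is a product of compact intervals and singletons, hence compact by Tychonoff and
  closed because the space is Hausdorff. The origin is an interior point.\<close>

lemma window_box_window:
  assumes "B > 0"
  shows "window k (box_window k B)"
proof -
  let ?E = "Euclidean_space k" and ?W = "box_window k B"
  have sub: "?W \<subseteq> topspace ?E" by (auto simp: box_window_def topspace_Euclidean_space)
  have "?W = (\<Pi>\<^sub>E i\<in>UNIV. if i < k then {-B..B} else {0})"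
    by (auto simp: box_window_def PiE_iff abs_le_iff split: if_splits)
      (metis minus_le_iff not_le)+
  then have "compactin (powertop_real UNIV) ?W"
    by (auto simp: compactin_PiE)
  then have comp: "compactin ?E ?W"
    using sub by (simp add: Euclidean_space_def compactin_subtopology)
  then have "?E closure_of ?W = ?W"
    using Hausdorff_Euclidean_space by (simp add: closure_of_closedin compactin_imp_closedin)
  moreover
  \<comment> \<open>A basic open set of the product topology restricts only finitely many
    coordinates, so vanishing from index \<open>k\<close> on comes from the intersection with the
    subspace.\<close>
  let ?U = "(\<Pi>\<^sub>E i\<in>UNIV. if i < k then {-B<..<B} else UNIV) \<inter> topspace ?E"
  have "finite {i. (if i < k then {-B<..<B} else UNIV) \<noteq> (UNIV :: real set)}"
    by (rule finite_subset[of _ "{..<k}"]) auto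
  then have "openin (powertop_real UNIV) (\<Pi>\<^sub>E i\<in>UNIV. if i < k then {-B<..<B} else UNIV)"
    by (simp add: openin_PiE_gen)
  then have "openin ?E ?U"
    by (auto simp: Euclidean_space_def openin_subtopology)
  moreover have "?U \<subseteq> ?W"
    by (fastforce simp: box_window_def PiE_iff topspace_Euclidean_space abs_le_iff
        split: if_splits)
  ultimately have "?U \<subseteq> ?E interior_of ?W" by (meson interior_of_maximal)
  moreover have "(\<lambda>_. 0) \<in> ?U"
    using assms by (auto simp: topspace_Euclidean_space)
  ultimately show ?thesis
    using sub comp \<open>?E closure_of ?W = ?W\<close> by (auto simp: window_def)
qed

subsection \<open>Bounded conjugate values\<close>

text \<open>The degree of \<open>p\<close> is left free because a convexity step raises it;
  reduction below the degree of \<open>lam\<close> happens only once, at the end.\<close>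

definition conj_bounded :: "complex \<Rightarrow> (nat \<Rightarrow> real) \<Rightarrow> real \<Rightarrow> complex set" where
  "conj_bounded lam \<mu> B = {poly (map_poly of_int p) lam | p.
     \<forall>i<internal_dim lam. \<bar>poly (map_poly of_int p) (\<mu> i)\<bar> \<le> B}"

lemma lambda_convex_conj_bounded:
  assumes "\<And>i. i < internal_dim lam \<Longrightarrow> 0 \<le> \<mu> i \<and> \<mu> i \<le> 1"
  shows "lambda_convex lam (conj_bounded lam \<mu> B)"
  unfolding lambda_convex_def
proof (intro ballI)
  fix a b assume "a \<in> conj_bounded lam \<mu> B" "b \<in> conj_bounded lam \<mu> B"
  then obtain p q where
    p: "a = poly (map_poly of_int p) lam"
      "\<And>i. i < internal_dim lam \<Longrightarrow> \<bar>poly (map_poly of_int p) (\<mu> i)\<bar> \<le> B" and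
    q: "b = poly (map_poly of_int q) lam"
      "\<And>i. i < internal_dim lam \<Longrightarrow> \<bar>poly (map_poly of_int q) (\<mu> i)\<bar> \<le> B"
    unfolding conj_bounded_def by blast
  define r where "r = [:1, -1:] * p + [:0, 1:] * q"
  \<comment> \<open>The type is kept general, as \<open>r\<close> is evaluated both at the complex
    \<open>lam\<close> and at the real \<open>\<mu> i\<close>.\<close>
  have r: "poly (map_poly of_int r) x
      = (1 - x) * poly (map_poly of_int p) x + x * poly (map_poly of_int q) x"
    for x :: "'a :: {comm_ring_1, ring_char_0}"
    unfolding r_def map_poly_of_int_add map_poly_of_int_mult
    by (simp add: map_poly_pCons algebra_simps)
  have "\<bar>poly (map_poly of_int r) (\<mu> i)\<bar> \<le> B" if i: "i < internal_dim lam" for i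
    \<comment> \<open>The two instances, for the values and for their negatives, bound the convex
      combination from above and from below.\<close>
    unfolding r using convex_bound_le[of "poly (map_poly of_int p) (\<mu> i)" B
        "poly (map_poly of_int q) (\<mu> i)" "1 - \<mu> i" "\<mu> i"]
      convex_bound_le[of "- poly (map_poly of_int p) (\<mu> i)" B
        "- poly (map_poly of_int q) (\<mu> i)" "1 - \<mu> i" "\<mu> i"]
      p(2)[OF i] q(2)[OF i] assms[OF i]
    by (simp add: abs_le_iff)
  then have "poly (map_poly of_int r) lam \<in> conj_bounded lam \<mu> B"
    unfolding conj_bounded_def by blast
  then show "(1 - lam) * a + lam * b \<in> conj_bounded lam \<mu> B"
    unfolding p q r .
qed

lemma finite_int_adjoin_conj_bounded:
  assumes "finite S" "S \<subseteq> int_adjoin lam"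
  obtains B where "B > 0" "S \<subseteq> conj_bounded lam \<mu> B"
proof -
  let ?k = "internal_dim lam"
  have "\<forall>s\<in>S. \<exists>p. s = poly (map_poly of_int p) lam"
    using assms(2) by (auto simp: int_adjoin_def)
  then obtain P where P: "\<And>s. s \<in> S \<Longrightarrow> s = poly (map_poly of_int (P s)) lam" by metis
  define v where "v s i = \<bar>poly (map_poly of_int (P s)) (\<mu> i)\<bar>" for s i
  \<comment> \<open>The sum dominates each of its nonnegative terms. The summand 1 keeps
    \<open>B\<close> positive even when the sum is empty or zero, so that the box has an
    interior.\<close>
  define B where "B = 1 + (\<Sum>s\<in>S. \<Sum>i<?k. v s i)"
  have v0: "v s i \<ge> 0" for s i by (simp add: v_def)
  have "v s i \<le> B" if "s \<in> S" "i < ?k" for s i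
  proof -
    have "v s i \<le> (\<Sum>i<?k. v s i)" using that v0 by (intro member_le_sum) auto
    also have "\<dots> \<le> (\<Sum>s\<in>S. \<Sum>i<?k. v s i)"
      using that v0 assms(1) by (intro member_le_sum[of s S "\<lambda>s. \<Sum>i<?k. v s i"]) (auto intro: sum_nonneg)
    finally show ?thesis by (simp add: B_def)
  qed
  then have "S \<subseteq> conj_bounded lam \<mu> B" using P unfolding conj_bounded_def v_def by blast
  moreover have "B > 0" using v0 by (simp add: B_def add_pos_nonneg sum_nonneg)
  ultimately show ?thesis using that by blast
qed

lemma conj_bounded_subset_scheme:
  assumes int: "algebraic_int lam" and enum: "enumerates_conjugates lam \<mu>"
  shows "conj_bounded lam \<mu> B
    \<subseteq> snd ` (scheme_lattice lam \<mu> \<inter> fst -` box_window (internal_dim lam) B)"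
proof
  let ?k = "internal_dim lam" and ?d = "alg_degree lam"
  fix z assume "z \<in> conj_bounded lam \<mu> B"
  then obtain p where p: "z = poly (map_poly of_int p) lam"
    "\<And>i. i < ?k \<Longrightarrow> \<bar>poly (map_poly of_int p) (\<mu> i)\<bar> \<le> B"
    unfolding conj_bounded_def by blast
  obtain r where r: "degree r < ?d"
    "\<And>z. z \<in> galois_conjugates lam \<Longrightarrow> poly (map_poly of_int r) z = poly (map_poly of_int p) z"
    using int_poly_reduce_degree[OF int, of p] by blast
  have "lam \<in> galois_conjugates lam"
    using rat_min_poly(3)[of lam] int by (auto simp: galois_conjugates_def)
  then have z: "z = (\<Sum>j<?d. of_int (coeff r j) * lam ^ j)"
    using r poly_map_poly_of_int_eq_sum[OF r(1)] p(1) by metis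
  have bound: "\<bar>\<Sum>j<?d. of_int (coeff r j) * \<mu> i ^ j\<bar> \<le> B" if i: "i < ?k" for i
  proof -
    have "complex_of_real (\<mu> i) \<in> galois_conjugates lam"
      using enum i by (auto simp: enumerates_conjugates_def bij_betw_def)
    from r(2)[OF this] have "poly (map_poly of_int r) (\<mu> i) = poly (map_poly of_int p) (\<mu> i)"
      by (simp add: poly_map_poly_of_int_of_real)
    with p(2)[OF i] show ?thesis
      by (simp flip: poly_map_poly_of_int_eq_sum[OF r(1)])
  qed
  \<comment> \<open>The coefficients of \<open>r\<close> are the integer coordinates of the lattice
    point: its internal components are the values of \<open>r\<close> at the \<open>\<mu> i\<close>,
    its physical component is \<open>z\<close>.\<close>
  let ?v = "(\<lambda>i. \<Sum>j<?d. of_int (coeff r j) * fst (lattice_vec lam \<mu> j) i,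
    \<Sum>j<?d. of_int (coeff r j) * snd (lattice_vec lam \<mu> j))"
  have "?v \<in> scheme_lattice lam \<mu>" unfolding scheme_lattice_def by blast
  moreover have "fst ?v \<in> box_window ?k B"
    using bound by (auto simp: box_window_def lattice_vec_def)
  moreover have "z = snd ?v" using z by (simp add: lattice_vec_def)
  ultimately show "z \<in> snd ` (scheme_lattice lam \<mu> \<inter> fst -` box_window ?k B)" by blast
qed

theorem proposition12p32:
  fixes lam :: complex and \<mu> :: "nat \<Rightarrow> real" and S :: "complex set"
  assumes "strong_PV lam"
    and "enumerates_conjugates lam \<mu>"
    and "finite S"
    and "S \<subseteq> int_adjoin lam"
  shows "\<exists>M. model_set lam \<mu> M \<and> Q_hull lam S \<subseteq> M"
proof -
  let ?k = "internal_dim lam"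
  from assms(3,4) obtain B where B: "B > 0" "S \<subseteq> conj_bounded lam \<mu> B"
    by (rule finite_int_adjoin_conj_bounded)
  \<comment> \<open>The strong PV property enters here: it makes \<open>1 - \<mu> i\<close> and
    \<open>\<mu> i\<close> weights of a convex combination.\<close>
  have "0 \<le> \<mu> i \<and> \<mu> i \<le> 1" if "i < ?k" for i
  proof -
    have "complex_of_real (\<mu> i) \<in> galois_conjugates lam - {lam, cnj lam}"
      using bij_betwE[OF assms(2)[unfolded enumerates_conjugates_def]] that by blast
    then have "complex_of_real (\<mu> i) \<in> complex_of_real ` {0<..<1}"
      using assms(1) unfolding strong_PV_def by blast
    then show ?thesis by auto
  qed
  then have "lambda_convex lam (conj_bounded lam \<mu> B)"
    by (rule lambda_convex_conj_bounded)
  with B(2) have "Q_hull lam S \<subseteq> conj_bounded lam \<mu> B"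
    unfolding Q_hull_def by (rule hull_minimal)
  also have "\<dots> \<subseteq> snd ` (scheme_lattice lam \<mu> \<inter> fst -` box_window ?k B)"
    using assms(1,2) by (intro conj_bounded_subset_scheme) (auto simp: strong_PV_def)
  finally show ?thesis
    using window_box_window[OF B(1)] unfolding model_set_def by blast
qed

end
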